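(* Let $X$ be a real locally convex Hausdorff topological vector space, $\mathscr P_0(X^* )$ the set of nonempty weak*-closed convex subsets of $X^*$, $T$ a nonempty index set, $\emptyset\ne\mathcal U_t\subset\mathscr P_0(X^* )\times\mathbb R$ for each $t\in T$, and $\mathfrak U:=\prod_{t\in T}\mathcal U_t$. Assume that the system $\sigma_{\mathcal A_t}(x)\le b_t$ for all $(\mathcal A_t,b_t)\in\mathcal U_t$, $t\in T$, has a solution $x\in X$. The following statements are equivalent: (i) For all $(c,s)\in X^*\times\mathbb R$ the next two assertions are equivalent: $\quad(\alpha'')$ for every $x\in X$: $\ \big[\sigma_{\mathcal A_t}(x)\le b_t\ \ \forall(\mathcal A_t,b_t)\in\mathcal U_t,\ \forall t\in T\big]\Longrightarrow\langle c,x\rangle\ge s$; $\quad(\gamma'')$ there exist $\bar t\in T$, a family $(\bar x_U^*,\bar r_U)_{U\in\mathfrak U}$ with $(\bar x_U^*,\bar r_U)\in U_{\bar t}$ for every $U\in\mathfrak U$, and $\bar\lambda\in\mathbb R_+^{(\mathfrak U)}$ such that $$\sum_{U\in\operatorname{supp}\bar\lambda}\bar\lambda_U\bar x_U^*=-c\quad\text{and}\quad\sum_{U\in\operatorname{supp}\bar\lambda}\bar\lambda_U\bar r_U\le-s.$$ (ii) $\bigcup_{t\in T}\operatorname{co}\operatorname{cone}\Big[\Big(\bigcup_{V\in\mathcal U_t}V\Big)\cup\{(0_{X^*},1)\}\Big]$ is a closed and convex subset of $X^*\times\mathbb R$.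
   Context: $X^*$ is the topological dual of $X$ with the weak* topology; $X^*\times\mathbb R$ has the product topology. $\sigma_{\mathcal A}(x)=\sup_{x^*\in\mathcal A}\langle x^*,x\rangle$. A pair $V=(V^1,V^2)\in\mathscr P_0(X^* )\times\mathbb R$ is identified with the subset $V^1\times\{V^2\}$ of $X^*\times\mathbb R$; $U\in\mathfrak U$ is written $U=(U_t)_{t\in T}$ with $U_t\in\mathcal U_t$. $\mathbb R_+^{(\mathfrak U)}$ is the set of families of nonnegative reals indexed by $\mathfrak U$ with finite support; empty sums are zero. $\operatorname{cone}B=\{\lambda b:\lambda\ge0,b\in B\}$, $\operatorname{co}$ is the convex hull. *)

theory Defs
  imports "HOL-Analysis.Analysis"
begin

text \<open>Real locally convex Hausdorff topological vector spaces.  \<open>convex\<close> is not available inside the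
  class specification, so it is unfolded there; see \<open>convex_nhds_base\<close>.\<close>

class locally_convex_space = real_vector + topological_ab_group_add + t2_space +
  assumes tendsto_scaleR_nhds:
    "LIM p (nhds c \<times>\<^sub>F nhds x). fst p *\<^sub>R snd p :> nhds (c *\<^sub>R x)"
  assumes convex_nhds_base_raw:
    "open S \<Longrightarrow> 0 \<in> S \<Longrightarrow>
      \<exists>C. (\<forall>x\<in>C. \<forall>y\<in>C. \<forall>u\<ge>0. \<forall>v\<ge>0. u + v = 1 \<longrightarrow> u *\<^sub>R x + v *\<^sub>R y \<in> C) \<and>
          (\<exists>W. open W \<and> 0 \<in> W \<and> W \<subseteq> C) \<and> C \<subseteq> S"

lemma convex_nhds_base:
  fixes S :: "'a::locally_convex_space set"
  assumes "open S" "0 \<in> S"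
  shows "\<exists>C. convex C \<and> 0 \<in> interior C \<and> C \<subseteq> S"
  using convex_nhds_base_raw[OF assms] unfolding convex_def interior_def by blast

instance real_normed_vector \<subseteq> locally_convex_space
proof
  show "LIM p (nhds c \<times>\<^sub>F nhds x). fst p *\<^sub>R snd p :> nhds (c *\<^sub>R x)" for c :: real and x :: 'a
    by (intro tendsto_scaleR filterlim_fst filterlim_snd)
  fix S :: "'a set"
  assume "open S" "0 \<in> S"
  then obtain e where e: "e > 0" "ball 0 e \<subseteq> S"
    by (auto simp: open_contains_ball)
  have "\<forall>x\<in>ball 0 e. \<forall>y\<in>ball 0 e. \<forall>u\<ge>0. \<forall>v\<ge>0. u + v = 1 \<longrightarrow> u *\<^sub>R x + v *\<^sub>R y \<in> ball (0::'a) e"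
    using convex_ball[of "0::'a" e] unfolding convex_def by blast
  moreover have "\<exists>W. open W \<and> 0 \<in> W \<and> W \<subseteq> ball (0::'a) e"
    using e by (intro exI[of _ "ball 0 e"]) auto
  ultimately show "\<exists>C. (\<forall>x\<in>C. \<forall>y\<in>C. \<forall>u\<ge>0. \<forall>v\<ge>0. u + v = 1 \<longrightarrow> u *\<^sub>R x + v *\<^sub>R y \<in> C) \<and>
      (\<exists>W. open W \<and> 0 \<in> W \<and> W \<subseteq> C) \<and> C \<subseteq> S"
    using e(2) by blast
qed


text \<open>The topological dual, as a type.\<close>

typedef (overloaded) 'a dual =
  "{f :: 'a::locally_convex_space \<Rightarrow> real. linear f \<and> continuous_on UNIV f}"
  morphisms dual_apply Dual
  by (rule exI[of _ "\<lambda>_. 0"]) (simp add: linear_zero)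

setup_lifting type_definition_dual

lemma linear_dual_apply: "linear (dual_apply f)"
  using dual_apply[of f] by simp

lemma continuous_on_dual_apply: "continuous_on UNIV (dual_apply f)"
  using dual_apply[of f] by simp

lemma dual_eqI: "(\<And>x. dual_apply f x = dual_apply g x) \<Longrightarrow> f = g"
  by (simp add: dual_apply_inject[symmetric] fun_eq_iff)

instantiation dual :: (locally_convex_space) real_vector
begin

lift_definition zero_dual :: "'a dual" is "\<lambda>_. 0"
  by (simp add: linear_zero)

lift_definition plus_dual :: "'a dual \<Rightarrow> 'a dual \<Rightarrow> 'a dual" is "\<lambda>f g x. f x + g x"
  by (simp add: linear_compose_add continuous_on_add)

lift_definition uminus_dual :: "'a dual \<Rightarrow> 'a dual" is "\<lambda>f x. - f x"
  by (simp add: linear_compose_neg continuous_on_minus)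

lift_definition minus_dual :: "'a dual \<Rightarrow> 'a dual \<Rightarrow> 'a dual" is "\<lambda>f g x. f x - g x"
  by (simp add: linear_compose_sub continuous_on_diff)

lift_definition scaleR_dual :: "real \<Rightarrow> 'a dual \<Rightarrow> 'a dual" is "\<lambda>c f x. c * f x"
  using linear_compose_scale_right[where 'b = real] by (auto intro: continuous_on_mult_left)

instance
  by standard (transfer; simp add: fun_eq_iff algebra_simps)+

end

lemmas dual_apply_simps [simp] =
  zero_dual.rep_eq plus_dual.rep_eq uminus_dual.rep_eq minus_dual.rep_eq scaleR_dual.rep_eq

text \<open>The dual carries the weak* topology, the coarsest one making all evaluations continuous.
  Thus \<open>open\<close> and \<open>closed\<close> on \<open>'a dual\<close> mean weak* open and weak* closed, and
  \<open>'a dual \<times> real\<close> has the corresponding product topology.\<close>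

instantiation dual :: (locally_convex_space) topological_space
begin

definition open_dual :: "'a dual set \<Rightarrow> bool" where
  "open_dual = generate_topology {(\<lambda>f. dual_apply f x) -` B | x B. open B}"

instance
  by standard (auto simp: open_dual_def intro: generate_topology.intros)

end


definition closed_convex_sets :: "'a::locally_convex_space dual set set" where
  "closed_convex_sets = {A. A \<noteq> {} \<and> closed A \<and> convex A}"

text \<open>The support function may take the value \<open>\<infinity>\<close>.\<close>

definition support_fun :: "'a::locally_convex_space dual set \<Rightarrow> 'a \<Rightarrow> ereal" where
  "support_fun A x = (SUP f\<in>A. ereal (dual_apply f x))"

definition pair_set :: "'a::locally_convex_space dual set \<times> real \<Rightarrow> ('a dual \<times> real) set" where
  "pair_set V = fst V \<times> {snd V}"

definition feasible ::
  "'t set \<Rightarrow> ('t \<Rightarrow> ('a::locally_convex_space dual set \<times> real) set) \<Rightarrow> 'a \<Rightarrow> bool" where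
  "feasible T \<U> x \<longleftrightarrow> (\<forall>t\<in>T. \<forall>(A, b)\<in>\<U> t. support_fun A x \<le> ereal b)"

definition supp_on :: "'i set \<Rightarrow> ('i \<Rightarrow> real) \<Rightarrow> 'i set" where
  "supp_on I l = {i \<in> I. l i \<noteq> 0}"

text \<open>Only the values on \<open>I\<close> matter; functions are total, values outside \<open>I\<close> are ignored.\<close>

definition nonneg_finite_support :: "'i set \<Rightarrow> ('i \<Rightarrow> real) set" where
  "nonneg_finite_support I = {l. (\<forall>i\<in>I. 0 \<le> l i) \<and> finite (supp_on I l)}"

text \<open>\<open>cone hull B\<close> is the set of all \<open>c *\<^sub>R b\<close> with \<open>c \<ge> 0\<close> and \<open>b \<in> B\<close>
  (\<open>cone_hull_expl\<close>); no sums are formed before taking the convex hull.\<close>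

definition robust_moment_cone ::
  "'t set \<Rightarrow> ('t \<Rightarrow> ('a::locally_convex_space dual set \<times> real) set) \<Rightarrow> ('a dual \<times> real) set" where
  "robust_moment_cone T \<U> =
     (\<Union>t\<in>T. convex hull (cone hull ((\<Union>V\<in>\<U> t. pair_set V) \<union> {(0, 1)})))"

end

(* Up to sign, (c, s) satisfies the dual condition exactly when it lies in the moment cone M, and
   it satisfies the primal one exactly when it lies in the set N of affine bounds valid on the
   feasible set.  N is always closed and convex.  Conversely, if M is closed and convex, a point
   outside M is separated from M by a weak* continuous functional (x, -a) with a >= 0.  For a > 0,
   x / a is a feasible point violating the bound; for a = 0, x is a recession direction of the
   feasible set along which the bound eventually fails. *)
theory Submission
  imports Defs
begin

section \<open>Separating a convex set from the origin by finitely many linear functionals\<close>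

text \<open>Separation after projecting to finitely many coordinates.  The separating vector is the point
  of minimal Euclidean norm in the closure of the image of \<open>C\<close>; it is the limit of a minimising
  sequence, which is Cauchy by the parallelogram law.\<close>

lemma finite_functionals_separation:
  fixes g :: "'i \<Rightarrow> 'v::real_vector \<Rightarrow> real"
  assumes I: "finite I" and lin: "\<And>i. i \<in> I \<Longrightarrow> linear (g i)" and C: "convex C"
    and e: "e > 0" "\<And>c. c \<in> C \<Longrightarrow> e \<le> (\<Sum>i\<in>I. (g i c)\<^sup>2)"
  shows "\<exists>z. \<forall>c\<in>C. 0 < (\<Sum>i\<in>I. z i * g i c)"
proof (cases "C = {}")
  case True
  then show ?thesis by simp
next
  case False
  define Q where "Q c = (\<Sum>i\<in>I. (g i c)\<^sup>2)" for c
  define d where "d = Inf (Q ` C)"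
  have bdd: "bdd_below (Q ` C)"
    using e(2) by (auto simp: Q_def intro!: bdd_belowI[of _ e])
  have d_le: "d \<le> Q c" if "c \<in> C" for c
    unfolding d_def using bdd that by (rule cINF_lower)
  have "e \<le> d"
    unfolding d_def using False e(2) by (auto simp: Q_def intro!: cINF_greatest)
  have "\<exists>c\<in>C. Q c < d + inverse (real (Suc n))" for n
    using cINF_less_iff[OF False bdd, of "d + inverse (real (Suc n))"] by (simp add: d_def)
  then obtain k where kC: "\<And>n. k n \<in> C" and k: "\<And>n. Q (k n) < d + inverse (real (Suc n))"
    by metis
  have parallelogram: "Q (a - b) = 2 * Q a + 2 * Q b - 4 * Q ((1/2) *\<^sub>R a + (1/2) *\<^sub>R b)" for a b
    unfolding Q_def sum_distrib_left sum.distrib[symmetric] sum_subtractf[symmetric]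
    by (intro sum.cong refl)
      (simp add: lin linear_diff linear_add linear_scale power2_eq_square field_simps)
  \<comment> \<open>The midpoint of \<open>k m\<close> and \<open>k n\<close> lies in
    \<open>C\<close>, so its \<open>Q\<close>-value is at least \<open>d\<close>; the terms in
    \<open>d\<close> then cancel in the parallelogram law and only the two excesses over the infimum
    remain.\<close>
  have close: "Q (k m - k n) \<le> 2 * inverse (real (Suc m)) + 2 * inverse (real (Suc n))" for m n
  proof -
    have "(1/2) *\<^sub>R k m + (1/2) *\<^sub>R k n \<in> C"
      using C kC by (intro convexD) auto
    then show ?thesis
      using d_le[of "(1/2) *\<^sub>R k m + (1/2) *\<^sub>R k n"] k[of m] k[of n] parallelogram[of "k m" "k n"]
      by linarith
  qed
  have "Cauchy (\<lambda>n. g i (k n))" if "i \<in> I" for i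
  proof (rule metric_CauchyI)
    fix r :: real
    assume r: "r > 0"
    then obtain N where N: "inverse (real (Suc N)) < r\<^sup>2 / 4"
      using reals_Archimedean[of "r\<^sup>2 / 4"] by auto
    have "dist (g i (k m)) (g i (k n)) < r" if mn: "m \<ge> N" "n \<ge> N" for m n
    proof -
      have "(g i (k m) - g i (k n))\<^sup>2 = (g i (k m - k n))\<^sup>2"
        using lin[OF \<open>i \<in> I\<close>] by (simp add: linear_diff)
      also have "\<dots> \<le> Q (k m - k n)"
        unfolding Q_def using I \<open>i \<in> I\<close> by (intro member_le_sum) auto
      also have "\<dots> \<le> 2 * inverse (real (Suc m)) + 2 * inverse (real (Suc n))"
        by (rule close)
      also have "\<dots> \<le> 4 * inverse (real (Suc N))"
      proof -
        have "inverse (real (Suc m)) \<le> inverse (real (Suc N))"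
          "inverse (real (Suc n)) \<le> inverse (real (Suc N))"
          using mn by (auto intro!: le_imp_inverse_le)
        then show ?thesis by linarith
      qed
      also have "\<dots> < r\<^sup>2" using N by simp
      finally have "\<bar>g i (k m) - g i (k n)\<bar>\<^sup>2 < r\<^sup>2" by simp
      then show ?thesis
        using r by (simp add: dist_real_def power2_less_imp_less)
    qed
    then show "\<exists>M. \<forall>m\<ge>M. \<forall>n\<ge>M. dist (g i (k m)) (g i (k n)) < r" by blast
  qed
  then have "\<forall>i. \<exists>z. i \<in> I \<longrightarrow> (\<lambda>n. g i (k n)) \<longlonglongrightarrow> z"
    using Cauchy_convergent_iff convergent_def by metis
  \<comment> \<open>Only the coordinates converge: \<open>z\<close> is a limit of images of points
    of \<open>C\<close> and need not be such an image, so everything about it is obtained by passing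
    to the limit along \<open>k\<close>.\<close>
  then obtain z where z: "\<And>i. i \<in> I \<Longrightarrow> (\<lambda>n. g i (k n)) \<longlonglongrightarrow> z i"
    by metis
  have Qz: "(\<lambda>n. Q (k n)) \<longlonglongrightarrow> (\<Sum>i\<in>I. (z i)\<^sup>2)"
    unfolding Q_def by (intro tendsto_sum tendsto_power z)
  have Qz_eq: "(\<Sum>i\<in>I. (z i)\<^sup>2) = d"
  proof (rule antisym)
    have "(\<Sum>i\<in>I. (z i)\<^sup>2) \<le> d + 0"
      by (rule LIMSEQ_le[OF Qz tendsto_add[OF tendsto_const LIMSEQ_inverse_real_of_nat]])
        (blast intro: less_imp_le k)
    then show "(\<Sum>i\<in>I. (z i)\<^sup>2) \<le> d" by simp
    show "d \<le> (\<Sum>i\<in>I. (z i)\<^sup>2)"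
      using Qz kC d_le by (intro LIMSEQ_le_const) auto
  qed
  have "0 < (\<Sum>i\<in>I. z i * g i c)" if c: "c \<in> C" for c
  proof -
    define S where "S = (\<Sum>i\<in>I. z i * (g i c - z i))"
    define R where "R = (\<Sum>i\<in>I. (g i c - z i)\<^sup>2)"
    \<comment> \<open>First variation at the minimiser: moving from \<open>z\<close> a fraction
      \<open>t\<close> towards the image of \<open>c\<close> changes the squared norm by
      \<open>2 * t * S + t\<^sup>2 * R\<close>. By convexity this change cannot be negative, which
      rules out \<open>S < 0\<close> for small \<open>t\<close>.\<close>
    have "0 \<le> S"
    proof (rule ccontr)
      assume "\<not> 0 \<le> S"
      have "R \<ge> 0" unfolding R_def by (simp add: sum_nonneg)
      have quad: "0 \<le> 2 * t * S + t\<^sup>2 * R" if t: "0 < t" "t \<le> 1" for t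
      proof -
        have "(\<lambda>n. \<Sum>i\<in>I. ((1 - t) * g i (k n) + t * g i c)\<^sup>2)
            \<longlonglongrightarrow> (\<Sum>i\<in>I. ((1 - t) * z i + t * g i c)\<^sup>2)"
          by (intro tendsto_intros z)
        moreover have "d \<le> (\<Sum>i\<in>I. ((1 - t) * g i (k n) + t * g i c)\<^sup>2)" for n
        proof -
          have "(1 - t) *\<^sub>R k n + t *\<^sub>R c \<in> C"
            using C kC c t by (intro convexD) auto
          then show ?thesis
            using d_le[of "(1 - t) *\<^sub>R k n + t *\<^sub>R c"]
            by (simp add: Q_def lin linear_add linear_scale)
        qed
        ultimately have "d \<le> (\<Sum>i\<in>I. ((1 - t) * z i + t * g i c)\<^sup>2)"
          by (intro LIMSEQ_le_const) auto
        also have "\<dots> = (\<Sum>i\<in>I. (z i)\<^sup>2) + 2 * t * S + t\<^sup>2 * R"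
          unfolding S_def R_def sum_distrib_left sum.distrib[symmetric]
          by (intro sum.cong refl) (simp add: power2_eq_square algebra_simps)
        finally show ?thesis by (simp add: Qz_eq)
      qed
      \<comment> \<open>Small enough for \<open>t * R \<le> - S\<close>, so that
        \<open>2 * S + t * R\<close> is at most \<open>S\<close> and hence negative. The summand 1
        keeps the denominator positive when \<open>R = 0\<close>, and \<open>min 1\<close> keeps the
        convex combination legitimate.\<close>
      define t where "t = min 1 (- S / (R + 1))"
      have t: "0 < t" "t \<le> 1" "t \<le> - S / (R + 1)"
        using \<open>\<not> 0 \<le> S\<close> \<open>R \<ge> 0\<close> by (auto simp: t_def divide_neg_pos)
      then have tR: "t * (R + 1) \<le> - S"
        using \<open>R \<ge> 0\<close> by (subst (asm) pos_le_divide_eq) auto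
      have "0 \<le> t * (2 * S + t * R)"
        using quad[OF t(1,2)] by (simp add: power2_eq_square algebra_simps)
      then have "0 \<le> 2 * S + t * R"
        using t(1) by (simp add: zero_le_mult_iff)
      moreover have "t * R \<le> - S" using tR t(1) by (simp add: algebra_simps)
      ultimately show False using \<open>\<not> 0 \<le> S\<close> by linarith
    qed
    moreover have "S = (\<Sum>i\<in>I. z i * g i c) - d"
      by (simp add: S_def Qz_eq[symmetric] sum_subtractf[symmetric] power2_eq_square algebra_simps)
    ultimately show ?thesis using \<open>e \<le> d\<close> e(1) by linarith
  qed
  then show ?thesis by blast
qed

section \<open>Weak* neighbourhoods and separation in the product of the dual with the reals\<close>

lemma continuous_on_dual_eval: "continuous_on S (\<lambda>f :: 'a::locally_convex_space dual. dual_apply f x)"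
proof -
  have "open ((\<lambda>f. dual_apply f x) -` B)" if "open B" for B
    unfolding open_dual_def using that by (intro generate_topology.Basis) blast
  then have "continuous_on UNIV (\<lambda>f :: 'a dual. dual_apply f x)"
    by (simp add: continuous_on_open_vimage)
  then show ?thesis by (rule continuous_on_subset) simp
qed

text \<open>By induction over the generated topology: an intersection unites the test points and
  takes the smaller radius, a union inherits from one member, and a subbasic set needs only its own
  evaluation point.\<close>

lemma open_dual_nhds:
  fixes A :: "'a::locally_convex_space dual set"
  assumes "open A" "f0 \<in> A"
  obtains F e where "finite F" "e > 0"
    "\<And>f. (\<And>x. x \<in> F \<Longrightarrow> \<bar>dual_apply f x - dual_apply f0 x\<bar> < e) \<Longrightarrow> f \<in> A"
proof -
  have "f0 \<in> A \<longrightarrow> (\<exists>F e. finite F \<and> e > 0 \<and>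
      (\<forall>f. (\<forall>x\<in>F. \<bar>dual_apply f x - dual_apply f0 x\<bar> < e) \<longrightarrow> f \<in> A))"
    using assms(1) unfolding open_dual_def
  proof (induction rule: generate_topology.induct)
    case UNIV
    then show ?case by (auto intro!: exI[of _ "{}"] exI[of _ 1])
  next
    case (Int a b)
    show ?case
    proof
      assume "f0 \<in> a \<inter> b"
      with Int.IH obtain F e G e' where
        "finite F" "e > 0" "\<forall>f. (\<forall>x\<in>F. \<bar>dual_apply f x - dual_apply f0 x\<bar> < e) \<longrightarrow> f \<in> a"
        "finite G" "e' > 0" "\<forall>f. (\<forall>x\<in>G. \<bar>dual_apply f x - dual_apply f0 x\<bar> < e') \<longrightarrow> f \<in> b"
        by auto
      then show "\<exists>F e. finite F \<and> e > 0 \<and>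
          (\<forall>f. (\<forall>x\<in>F. \<bar>dual_apply f x - dual_apply f0 x\<bar> < e) \<longrightarrow> f \<in> a \<inter> b)"
        by (intro exI[of _ "F \<union> G"] exI[of _ "min e e'"]) auto
    qed
  next
    case (UN K)
    then show ?case by (meson UnionE UnionI)
  next
    case (Basis s)
    then obtain x B where s: "s = (\<lambda>f. dual_apply f x) -` B" "open B" by auto
    show ?case
    proof
      assume "f0 \<in> s"
      then have "dual_apply f0 x \<in> B" by (simp add: s)
      then obtain e where "e > 0" "ball (dual_apply f0 x) e \<subseteq> B"
        using s(2) open_contains_ball by metis
      then show "\<exists>F e. finite F \<and> e > 0 \<and>
          (\<forall>f. (\<forall>x\<in>F. \<bar>dual_apply f x - dual_apply f0 x\<bar> < e) \<longrightarrow> f \<in> s)"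
        by (intro exI[of _ "{x}"] exI[of _ e])
          (auto simp: s subset_eq dist_real_def abs_minus_commute)
    qed
  qed
  then obtain F e where "finite F" "e > 0"
    "\<forall>f. (\<forall>x\<in>F. \<bar>dual_apply f x - dual_apply f0 x\<bar> < e) \<longrightarrow> f \<in> A"
    using assms(2) by auto
  then show ?thesis by (intro that) auto
qed

lemma dual_apply_linear: "linear (\<lambda>k :: 'a::locally_convex_space dual \<times> real. dual_apply (fst k) x)"
  by (rule linearI) auto

lemma dual_apply_sum_scaleR:
  "dual_apply f (\<Sum>x\<in>F. z x *\<^sub>R h x) = (\<Sum>x\<in>F. z x * dual_apply f (h x))"
  by (simp add: linear_sum[OF linear_dual_apply] linear_scale[OF linear_dual_apply])

text \<open>A basic neighbourhood that misses \<open>K\<close> involves finitely many evaluations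
  and the real coordinate, so the finite-dimensional separation applies. A linear combination of
  evaluations is again the evaluation at one point, which is why the separating functional comes
  from some \<open>x\<close> in the original space.\<close>

lemma dual_prod_separation:
  fixes K :: "('a::locally_convex_space dual \<times> real) set"
  assumes "closed K" "convex K" "(f0, r0) \<notin> K"
  obtains x a where "\<And>f r. (f, r) \<in> K \<Longrightarrow> dual_apply f0 x + a * r0 < dual_apply f x + a * r"
proof -
  have "open (- K)" "(f0, r0) \<in> - K" using assms by auto
  then obtain A B where AB: "open A" "open B" "f0 \<in> A" "r0 \<in> B" "A \<times> B \<subseteq> - K"
    by (elim open_prod_elim) auto
  obtain F e where F: "finite F" "e > 0"
    "\<And>f. (\<And>x. x \<in> F \<Longrightarrow> \<bar>dual_apply f x - dual_apply f0 x\<bar> < e) \<Longrightarrow> f \<in> A"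
    using open_dual_nhds[OF AB(1,3)] by metis
  obtain e' where e': "e' > 0" "ball r0 e' \<subseteq> B"
    using AB open_contains_ball by metis
  \<comment> \<open>\<open>None\<close> indexes the real coordinate, \<open>Some x\<close> the
    evaluation at a test point \<open>x\<close>.\<close>
  define I where "I = insert None (Some ` F)"
  define g :: "'a option \<Rightarrow> 'a dual \<times> real \<Rightarrow> real"
    where "g i k = (case i of None \<Rightarrow> snd k | Some x \<Rightarrow> dual_apply (fst k) x)" for i k
  define C where "C = (\<lambda>k. k - (f0, r0)) ` K"
  define m where "m = min e e'"
  have "finite I" using F by (simp add: I_def)
  moreover have "linear (g i)" if "i \<in> I" for i
    unfolding g_def by (cases i) (simp_all add: dual_apply_linear linear_snd)
  moreover have "convex C"
    unfolding C_def using assms(2) convex_translation_subtract by blast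
  moreover have "m\<^sup>2 > 0" using F(2) e'(1) by (simp add: m_def)
  \<comment> \<open>A point of \<open>K\<close> lies outside \<open>A \<times> B\<close>, so at
    least one coordinate differs from that of \<open>(f0, r0)\<close> by \<open>m\<close> or more;
    this keeps the image of \<open>C\<close> away from the origin.\<close>
  moreover have "m\<^sup>2 \<le> (\<Sum>i\<in>I. (g i c)\<^sup>2)" if c: "c \<in> C" for c
  proof -
    obtain f r where fr: "(f, r) \<in> K" "c = (f - f0, r - r0)"
      using c by (auto simp: C_def)
    then have "f \<notin> A \<or> r \<notin> B" using AB(5) by auto
    then have "\<exists>i\<in>I. m \<le> \<bar>g i c\<bar>"
    proof
      assume "f \<notin> A"
      then obtain x where "x \<in> F" "\<not> \<bar>dual_apply f x - dual_apply f0 x\<bar> < e" using F(3) by blast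
      then show ?thesis
        by (intro bexI[of _ "Some x"]) (auto simp: g_def fr m_def I_def)
    next
      assume "r \<notin> B"
      then have "\<not> \<bar>r - r0\<bar> < e'"
        using e'(2) by (auto simp: subset_eq dist_real_def abs_minus_commute)
      then show ?thesis
        by (intro bexI[of _ None]) (auto simp: g_def fr m_def I_def)
    qed
    then obtain i where i: "i \<in> I" "m \<le> \<bar>g i c\<bar>" by blast
    then have "m\<^sup>2 \<le> (g i c)\<^sup>2"
      using F(2) e'(1) by (intro abs_le_square_iff[THEN iffD1]) (simp add: m_def)
    also have "\<dots> \<le> (\<Sum>i\<in>I. (g i c)\<^sup>2)"
      using i(1) \<open>finite I\<close> by (intro member_le_sum) auto
    finally show ?thesis .
  qed
  ultimately have "\<exists>z. \<forall>c\<in>C. 0 < (\<Sum>i\<in>I. z i * g i c)"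
    by (rule finite_functionals_separation)
  then obtain z where z: "\<forall>c\<in>C. 0 < (\<Sum>i\<in>I. z i * g i c)" by blast
  define x where "x = (\<Sum>y\<in>F. z (Some y) *\<^sub>R y)"
  have "dual_apply f0 x + z None * r0 < dual_apply f x + z None * r" if "(f, r) \<in> K" for f r
  proof -
    have "(f - f0, r - r0) \<in> C" using that by (force simp: C_def)
    then have "0 < (\<Sum>i\<in>I. z i * g i (f - f0, r - r0))" by (rule z[rule_format])
    also have "\<dots> = z None * (r - r0) + dual_apply (f - f0) x"
      using F(1)
      by (simp add: I_def g_def sum.reindex x_def dual_apply_sum_scaleR
          right_diff_distrib sum_subtractf)
    finally show ?thesis by (simp add: algebra_simps)
  qed
  then show ?thesis using that by blast
qed

text \<open>On a cone the separating bound can be moved to zero: the origin belongs to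
  \<open>K\<close>, so the value at \<open>(f0, r0)\<close> is negative, and a negative value on
  \<open>K\<close> could be scaled down to that value.\<close>

lemma dual_prod_cone_separation:
  fixes K :: "('a::locally_convex_space dual \<times> real) set"
  assumes "closed K" "convex K" "cone K" "K \<noteq> {}" "(f0, r0) \<notin> K"
  obtains x a where "\<And>f r. (f, r) \<in> K \<Longrightarrow> dual_apply f x \<le> a * r" "dual_apply f0 x > a * r0"
proof -
  obtain x a where sep: "\<And>f r. (f, r) \<in> K \<Longrightarrow> dual_apply f0 x + a * r0 < dual_apply f x + a * r"
    using dual_prod_separation[OF assms(1,2,5)] by metis
  have cone: "(c *\<^sub>R f, c * r) \<in> K" if "(f, r) \<in> K" "c \<ge> 0" for f r c
    using mem_cone[OF assms(3) that] by simp
  have neg: "dual_apply f0 x + a * r0 < 0"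
    using assms(4) cone[of _ _ 0] sep[of 0 0] by fastforce
  have nonneg: "0 \<le> dual_apply f x + a * r" if "(f, r) \<in> K" for f r
  proof (rule ccontr)
    assume *: "\<not> 0 \<le> dual_apply f x + a * r"
    \<comment> \<open>The scaling that turns the value at \<open>(f, r)\<close> into exactly the
      value at \<open>(f0, r0)\<close>, against strict separation.\<close>
    define c where "c = (dual_apply f0 x + a * r0) / (dual_apply f x + a * r)"
    have "c \<ge> 0" using * neg by (simp add: c_def divide_nonpos_neg)
    then have "dual_apply f0 x + a * r0 < c * (dual_apply f x + a * r)"
      using sep[OF cone[OF that \<open>c \<ge> 0\<close>]] by (simp add: algebra_simps)
    then show False using * by (simp add: c_def)
  qed
  \<comment> \<open>Replacing \<open>x\<close> by \<open>- x\<close> moves the real part to the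
    right-hand side, giving the shape of a bound \<open>a * r\<close>.\<close>
  show ?thesis
  proof
    show "dual_apply f (- x) \<le> a * r" if "(f, r) \<in> K" for f r
      using nonneg[OF that] by (simp add: linear_neg[OF linear_dual_apply])
    show "dual_apply f0 (- x) > a * r0"
      using neg by (simp add: linear_neg[OF linear_dual_apply])
  qed
qed

section \<open>Moment cones and weak duality\<close>

lemma feasible_iff:
  "feasible T \<U> x \<longleftrightarrow> (\<forall>t\<in>T. \<forall>V\<in>\<U> t. \<forall>(f, b)\<in>pair_set V. dual_apply f x \<le> b)"
  unfolding feasible_def support_fun_def pair_set_def by (fastforce simp: SUP_le_iff)

text \<open>The part of the robust moment cone that belongs to one index. Each such part is convex,
  whereas their union need not be.\<close>

definition moment_cone ::
  "('a::locally_convex_space dual set \<times> real) set \<Rightarrow> ('a dual \<times> real) set" where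
  "moment_cone \<V> = convex hull (cone hull ((\<Union>V\<in>\<V>. pair_set V) \<union> {(0, 1)}))"

lemma robust_moment_cone_eq: "robust_moment_cone T \<U> = (\<Union>t\<in>T. moment_cone (\<U> t))"
  by (simp add: robust_moment_cone_def moment_cone_def)

lemma cone_moment_cone: "cone (moment_cone \<V>)"
  unfolding moment_cone_def by (intro cone_convex_hull cone_cone_hull)

lemma pair_set_subset_moment_cone: "V \<in> \<V> \<Longrightarrow> pair_set V \<subseteq> moment_cone \<V>"
  and vertical_in_moment_cone: "(0, 1) \<in> moment_cone \<V>"
  unfolding moment_cone_def by (blast intro: hull_inc)+

lemma moment_cone_closed:
  assumes "p \<in> moment_cone \<V>" "q \<in> moment_cone \<V>" "u \<ge> 0" "v \<ge> 0"
  shows "u *\<^sub>R p + v *\<^sub>R q \<in> moment_cone \<V>"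
proof -
  have "convex (moment_cone \<V>)" by (simp add: moment_cone_def)
  then show ?thesis
    using assms cone_moment_cone[of \<V>] convex_cone[of "moment_cone \<V>"] by simp
qed

text \<open>Serves as an induction principle: closure under nonnegative combinations contains both
  convexity and, with \<open>v = 0\<close>, the cone property, so inclusions are checked on
  generators alone.\<close>

lemma moment_cone_minimal:
  assumes "\<And>V. V \<in> \<V> \<Longrightarrow> pair_set V \<subseteq> S" "(0, 1) \<in> S"
    and "\<And>p q u v. p \<in> S \<Longrightarrow> q \<in> S \<Longrightarrow> u \<ge> 0 \<Longrightarrow> v \<ge> 0 \<Longrightarrow> u *\<^sub>R p + v *\<^sub>R q \<in> S"
  shows "moment_cone \<V> \<subseteq> S"
proof -
  have "convex S" using assms(3) by (simp add: convex_def)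
  moreover have "cone S"
    using assms(3)[where v = 0] by (fastforce simp: cone_def)
  ultimately show ?thesis
    unfolding moment_cone_def using assms(1,2) by (intro hull_minimal) auto
qed

text \<open>Weak duality: the affine bounds valid at \<open>x\<close> contain all generators and are
  preserved by nonnegative combinations.\<close>

lemma moment_cone_below_feasible:
  assumes "feasible T \<U> x" "t \<in> T" "(f, r) \<in> moment_cone (\<U> t)"
  shows "dual_apply f x \<le> r"
proof -
  have "moment_cone (\<U> t) \<subseteq> {(f, r). dual_apply f x \<le> r}"
  proof (rule moment_cone_minimal)
    show "pair_set V \<subseteq> {(f, r). dual_apply f x \<le> r}" if "V \<in> \<U> t" for V
      using assms(1,2) that by (fastforce simp: feasible_iff)
  qed (auto intro!: add_mono mult_left_mono)
  then show ?thesis using assms(3) by blast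
qed

section \<open>Dual certificates and their agreement with the moment cone\<close>

text \<open>The pairs \<open>(-c, -s)\<close> for which the dual certificate exists with index \<open>t\<close>.\<close>

definition certified_pairs ::
  "'t set \<Rightarrow> ('t \<Rightarrow> ('a::locally_convex_space dual set \<times> real) set) \<Rightarrow> 't \<Rightarrow> ('a dual \<times> real) set" where
  "certified_pairs T \<U> t = {(f, b). \<exists>xs. \<exists>r. \<exists>l \<in> nonneg_finite_support (PiE T \<U>).
     (\<forall>U \<in> PiE T \<U>. (xs U, r U) \<in> pair_set (U t)) \<and>
     (\<Sum>U \<in> supp_on (PiE T \<U>) l. l U *\<^sub>R xs U) = f \<and>
     (\<Sum>U \<in> supp_on (PiE T \<U>) l. l U * r U) \<le> b}"

lemma certified_pairsI:
  assumes "l \<in> nonneg_finite_support (PiE T \<U>)"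
    and "\<And>U. U \<in> PiE T \<U> \<Longrightarrow> (xs U, r U) \<in> pair_set (U t)"
    and "(\<Sum>U \<in> supp_on (PiE T \<U>) l. l U *\<^sub>R xs U) = f"
    and "(\<Sum>U \<in> supp_on (PiE T \<U>) l. l U * r U) \<le> b"
  shows "(f, b) \<in> certified_pairs T \<U> t"
  using assms unfolding certified_pairs_def by blast

lemma certified_pairsE:
  assumes "(f, b) \<in> certified_pairs T \<U> t"
  obtains xs r l where "l \<in> nonneg_finite_support (PiE T \<U>)"
    and "\<And>U. U \<in> PiE T \<U> \<Longrightarrow> (xs U, r U) \<in> pair_set (U t)"
    and "(\<Sum>U \<in> supp_on (PiE T \<U>) l. l U *\<^sub>R xs U) = f"
    and "(\<Sum>U \<in> supp_on (PiE T \<U>) l. l U * r U) \<le> b"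
  using assms unfolding certified_pairs_def by blast

text \<open>A certificate is a nonnegative combination of generators, up to the slack in its
  inequality; a multiple of \<open>(0, 1)\<close> supplies that slack.\<close>

lemma certified_pairs_subset_moment_cone:
  assumes "t \<in> T"
  shows "certified_pairs T \<U> t \<subseteq> moment_cone (\<U> t)"
proof (clarify)
  fix f b
  assume "(f, b) \<in> certified_pairs T \<U> t"
  then obtain xs r l where l: "l \<in> nonneg_finite_support (PiE T \<U>)"
    and sel: "\<And>U. U \<in> PiE T \<U> \<Longrightarrow> (xs U, r U) \<in> pair_set (U t)"
    and f: "(\<Sum>U \<in> supp_on (PiE T \<U>) l. l U *\<^sub>R xs U) = f"
    and b: "(\<Sum>U \<in> supp_on (PiE T \<U>) l. l U * r U) \<le> b"
    by (elim certified_pairsE) blast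
  let ?S = "supp_on (PiE T \<U>) l"
  have "(\<Sum>U \<in> J. l U *\<^sub>R (xs U, r U)) \<in> moment_cone (\<U> t)" if "finite J" "J \<subseteq> ?S" for J
    using that
  proof (induction J)
    case empty
    then show ?case
      using moment_cone_closed[OF vertical_in_moment_cone vertical_in_moment_cone, of 0 0]
      by (simp add: zero_prod_def)
  next
    case (insert U J)
    have U: "U \<in> PiE T \<U>" using insert by (auto simp: supp_on_def)
    then have "(xs U, r U) \<in> moment_cone (\<U> t)"
      using sel[OF U] pair_set_subset_moment_cone[of "U t" "\<U> t"] PiE_mem[OF U assms] by blast
    moreover have "0 \<le> l U" using l U by (auto simp: nonneg_finite_support_def)
    ultimately show ?case
      using insert moment_cone_closed[of "(xs U, r U)" _ _ "l U" 1] by simp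
  qed
  moreover have "finite ?S" using l by (simp add: nonneg_finite_support_def)
  ultimately have "(\<Sum>U \<in> ?S. l U *\<^sub>R (xs U, r U)) \<in> moment_cone (\<U> t)" by blast
  also have "(\<Sum>U \<in> ?S. l U *\<^sub>R (xs U, r U)) = (f, \<Sum>U \<in> ?S. l U * r U)"
    by (simp add: prod_eq_iff fst_sum snd_sum f)
  finally show "(f, b) \<in> moment_cone (\<U> t)"
    using moment_cone_closed[OF _ vertical_in_moment_cone, of _ "\<U> t" 1
        "b - (\<Sum>U \<in> ?S. l U * r U)"] b by fastforce
qed

text \<open>Convexity of the sets \<open>U t\<close> lets two certified_pairs be merged into one selection: on each \<open>U\<close> the two
  selected points are replaced by their weighted mean.\<close>

lemma certified_pairs_closed:
  assumes "t \<in> T" "\<U> t \<subseteq> closed_convex_sets \<times> UNIV"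
    and p: "(f, b) \<in> certified_pairs T \<U> t" and p': "(f', b') \<in> certified_pairs T \<U> t"
    and uv: "u \<ge> 0" "v \<ge> 0"
  shows "u *\<^sub>R (f, b) + v *\<^sub>R (f', b') \<in> certified_pairs T \<U> t"
proof -
  let ?P = "PiE T \<U>"
  obtain xs r l where l: "l \<in> nonneg_finite_support ?P"
    and sel: "\<And>U. U \<in> ?P \<Longrightarrow> (xs U, r U) \<in> pair_set (U t)"
    and f: "(\<Sum>U \<in> supp_on ?P l. l U *\<^sub>R xs U) = f"
    and b: "(\<Sum>U \<in> supp_on ?P l. l U * r U) \<le> b"
    using p by (elim certified_pairsE) blast
  obtain xs' r' l' where l': "l' \<in> nonneg_finite_support ?P"
    and sel': "\<And>U. U \<in> ?P \<Longrightarrow> (xs' U, r' U) \<in> pair_set (U t)"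
    and f': "(\<Sum>U \<in> supp_on ?P l'. l' U *\<^sub>R xs' U) = f'"
    and b': "(\<Sum>U \<in> supp_on ?P l'. l' U * r' U) \<le> b'"
    using p' by (elim certified_pairsE) blast
  define w where "w U = u * l U + v * l' U" for U
  \<comment> \<open>Where the merged weight vanishes the value is immaterial to the sums, and
    \<open>xs U\<close> keeps \<open>y\<close> a valid selection.\<close>
  define y where "y U = (if w U = 0 then xs U else
    (u * l U / w U) *\<^sub>R xs U + (v * l' U / w U) *\<^sub>R xs' U)" for U
  define J where "J = supp_on ?P l \<union> supp_on ?P l'"
  have finJ: "finite J" using l l' by (auto simp: J_def nonneg_finite_support_def)
  have JP: "J \<subseteq> ?P" by (auto simp: J_def supp_on_def)
  have nn: "0 \<le> u * l U" "0 \<le> v * l' U" if "U \<in> ?P" for U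
    using l l' uv that by (auto simp: nonneg_finite_support_def)
  have wJ: "supp_on ?P w \<subseteq> J"
    by (auto simp: J_def supp_on_def w_def)
  have w: "w \<in> nonneg_finite_support ?P"
    using nn finite_subset[OF wJ finJ] by (auto simp: nonneg_finite_support_def w_def)
  \<comment> \<open>Both second components equal \<open>snd (U t)\<close>, so only the dual
    components have to be averaged.\<close>
  have r': "r' U = r U" if "U \<in> ?P" for U
    using sel[OF that] sel'[OF that] by (simp add: pair_set_def)
  have y_sel: "(y U, r U) \<in> pair_set (U t)" if U: "U \<in> ?P" for U
  proof (cases "w U = 0")
    case True
    then show ?thesis using sel[OF U] by (simp add: y_def)
  next
    case False
    have "U t \<in> closed_convex_sets \<times> UNIV" using PiE_mem[OF U assms(1)] assms(2) by blast
    then have "convex (fst (U t))" by (auto simp: closed_convex_sets_def)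
    moreover have "xs U \<in> fst (U t)" "xs' U \<in> fst (U t)"
      using sel[OF U] sel'[OF U] by (auto simp: pair_set_def)
    moreover have "u * l U / w U + v * l' U / w U = 1"
      using False by (simp add: add_divide_distrib[symmetric] w_def)
    moreover have "0 \<le> u * l U / w U" "0 \<le> v * l' U / w U"
      using nn[OF U] by (auto simp: w_def)
    ultimately have "y U \<in> fst (U t)"
      using False by (simp add: y_def convexD)
    then show ?thesis using sel[OF U] by (simp add: pair_set_def)
  qed
  have wy: "w U *\<^sub>R y U = u *\<^sub>R l U *\<^sub>R xs U + v *\<^sub>R l' U *\<^sub>R xs' U" if U: "U \<in> ?P" for U
  proof (cases "w U = 0")
    case True
    \<comment> \<open>Two nonnegative terms with sum zero both vanish.\<close>
    then have "u * l U = 0" "v * l' U = 0" using nn[OF U] unfolding w_def by linarith+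
    then show ?thesis using True by auto
  next
    case False
    then show ?thesis by (simp add: y_def scaleR_add_right)
  qed
  have "(\<Sum>U \<in> supp_on ?P w. w U *\<^sub>R y U) = (\<Sum>U \<in> J. w U *\<^sub>R y U)"
    using finJ wJ JP by (intro sum.mono_neutral_left) (auto simp: supp_on_def)
  also have "\<dots> = u *\<^sub>R (\<Sum>U \<in> J. l U *\<^sub>R xs U) + v *\<^sub>R (\<Sum>U \<in> J. l' U *\<^sub>R xs' U)"
    unfolding scaleR_sum_right sum.distrib[symmetric] using wy JP by (intro sum.cong) auto
  also have "(\<Sum>U \<in> J. l U *\<^sub>R xs U) = f"
    unfolding f[symmetric] using finJ JP
    by (intro sum.mono_neutral_right) (auto simp: supp_on_def J_def)
  also have "(\<Sum>U \<in> J. l' U *\<^sub>R xs' U) = f'"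
    unfolding f'[symmetric] using finJ JP
    by (intro sum.mono_neutral_right) (auto simp: supp_on_def J_def)
  finally have F: "(\<Sum>U \<in> supp_on ?P w. w U *\<^sub>R y U) = u *\<^sub>R f + v *\<^sub>R f'" .
  have "(\<Sum>U \<in> supp_on ?P w. w U * r U) = (\<Sum>U \<in> J. w U * r U)"
    using finJ wJ JP by (intro sum.mono_neutral_left) (auto simp: supp_on_def)
  also have "\<dots> = u * (\<Sum>U \<in> J. l U * r U) + v * (\<Sum>U \<in> J. l' U * r' U)"
    unfolding sum_distrib_left sum.distrib[symmetric] using r' JP
    by (intro sum.cong) (auto simp: w_def algebra_simps)
  also have "(\<Sum>U \<in> J. l U * r U) = (\<Sum>U \<in> supp_on ?P l. l U * r U)"
    using finJ JP by (intro sum.mono_neutral_right) (auto simp: supp_on_def J_def)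
  also have "(\<Sum>U \<in> J. l' U * r' U) = (\<Sum>U \<in> supp_on ?P l'. l' U * r' U)"
    using finJ JP by (intro sum.mono_neutral_right) (auto simp: supp_on_def J_def)
  finally have G: "(\<Sum>U \<in> supp_on ?P w. w U * r U) \<le> u * b + v * b'"
    using b b' uv by (simp add: add_mono mult_left_mono)
  show ?thesis
    using certified_pairsI[OF w y_sel F G] by simp
qed

text \<open>Since certified pairs are closed under nonnegative combinations, only generators need
  certificates. The pair \<open>(0, 1)\<close> takes all weights zero; a point of \<open>V\<close>
  takes weight one on a single selection passing through \<open>V\<close> at
  \<open>t\<close>.\<close>

lemma moment_cone_certified:
  assumes t: "t \<in> T" and nonempty: "\<And>t. t \<in> T \<Longrightarrow> \<U> t \<noteq> {}"
    and sub: "\<U> t \<subseteq> closed_convex_sets \<times> UNIV"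
  shows "moment_cone (\<U> t) \<subseteq> certified_pairs T \<U> t"
proof (rule moment_cone_minimal)
  let ?P = "PiE T \<U>"
  have "\<exists>f. (f, snd (U t)) \<in> pair_set (U t)" if "U \<in> ?P" for U
  proof -
    have "U t \<in> closed_convex_sets \<times> UNIV" using PiE_mem[OF that t] sub by blast
    then show ?thesis by (auto simp: closed_convex_sets_def pair_set_def)
  qed
  \<comment> \<open>A certificate must choose a point for every \<open>U\<close>, including those of
    weight zero; \<open>h\<close> supplies these default choices.\<close>
  then obtain h where h: "\<And>U. U \<in> ?P \<Longrightarrow> (h U, snd (U t)) \<in> pair_set (U t)"
    by metis
  show "(0, 1) \<in> certified_pairs T \<U> t"
    by (rule certified_pairsI[where l = "\<lambda>_. 0", OF _ h])
      (auto simp: supp_on_def nonneg_finite_support_def)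
  show "pair_set V \<subseteq> certified_pairs T \<U> t" if V: "V \<in> \<U> t" for V
  proof clarify
    fix f b
    assume fb: "(f, b) \<in> pair_set V"
    \<comment> \<open>Some selection exists because every uncertainty set is nonempty; redirecting
      it at \<open>t\<close> makes it pass through \<open>V\<close>.\<close>
    obtain U1 where "U1 \<in> ?P" using nonempty by (metis PiE_eq_empty_iff ex_in_conv)
    define U0 where "U0 = U1(t := V)"
    have U0: "U0 \<in> ?P" "U0 t = V"
      using \<open>U1 \<in> ?P\<close> t V by (auto simp: U0_def PiE_iff extensional_def)
    have b: "b = snd V" using fb by (auto simp: pair_set_def)
    have supp: "supp_on ?P (\<lambda>U. of_bool (U = U0)) = {U0}"
      using U0 by (auto simp: supp_on_def)
    show "(f, b) \<in> certified_pairs T \<U> t"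
      by (rule certified_pairsI[where l = "\<lambda>U. of_bool (U = U0)" and xs = "h(U0 := f)"
            and r = "\<lambda>U. snd (U t)"])
        (use U0 fb b h in \<open>auto simp: supp nonneg_finite_support_def\<close>)
  qed
  show "u *\<^sub>R p + v *\<^sub>R q \<in> certified_pairs T \<U> t"
    if "p \<in> certified_pairs T \<U> t" "q \<in> certified_pairs T \<U> t" "u \<ge> 0" "v \<ge> 0" for p q u v
    using certified_pairs_closed[where \<U> = \<U>, OF t sub] that by (metis surj_pair)
qed

section \<open>Valid affine bounds on the feasible set, and the equivalence\<close>

lemma consequences_eq_moment_cone:
  assumes "T \<noteq> {}" "\<exists>x. feasible T \<U> x"
    and "closed (robust_moment_cone T \<U>)" "convex (robust_moment_cone T \<U>)"
  shows "{(f, r). \<forall>x. feasible T \<U> x \<longrightarrow> dual_apply f x \<le> r} = robust_moment_cone T \<U>"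
proof (rule antisym)
  let ?M = "robust_moment_cone T \<U>"
  show "?M \<subseteq> {(f, r). \<forall>x. feasible T \<U> x \<longrightarrow> dual_apply f x \<le> r}"
    using moment_cone_below_feasible by (fastforce simp: robust_moment_cone_eq)
  have vert: "(0, 1) \<in> ?M"
    using assms(1) vertical_in_moment_cone by (auto simp: robust_moment_cone_eq)
  have "cone ?M"
    using cone_moment_cone by (fastforce simp: robust_moment_cone_eq cone_def)
  have "(f0, r0) \<in> ?M" if cons: "\<And>x. feasible T \<U> x \<Longrightarrow> dual_apply f0 x \<le> r0" for f0 r0
  proof (rule ccontr)
    assume "(f0, r0) \<notin> ?M"
    then obtain x a where sep: "\<And>f r. (f, r) \<in> ?M \<Longrightarrow> dual_apply f x \<le> a * r"
      and sep0: "dual_apply f0 x > a * r0"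
      using dual_prod_cone_separation[OF assms(3,4) \<open>cone ?M\<close>, of f0 r0] vert by blast
    have "a \<ge> 0" using sep[OF vert] by simp
    \<comment> \<open>Base point for the case \<open>a = 0\<close>, where the separating
      \<open>x\<close> is only a direction and has to be added to a feasible point.\<close>
    obtain x0 where x0: "feasible T \<U> x0" using assms(2) by blast
    have feasI: "feasible T \<U> y" if "\<And>f r. (f, r) \<in> ?M \<Longrightarrow> dual_apply f y \<le> r" for y
      using that pair_set_subset_moment_cone by (fastforce simp: feasible_iff robust_moment_cone_eq)
    have x0M: "dual_apply f x0 \<le> r" if "(f, r) \<in> ?M" for f r
      using that moment_cone_below_feasible[OF x0] by (auto simp: robust_moment_cone_eq)
    show False
    proof (cases "a = 0")
      case True
      \<comment> \<open>Chosen so that \<open>c * dual_apply f0 x\<close> exceeds the gap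
        \<open>r0 - dual_apply f0 x0\<close> by at least one; the denominator is positive because
        \<open>a = 0\<close>.\<close>
      define c where "c = (\<bar>r0 - dual_apply f0 x0\<bar> + 1) / dual_apply f0 x"
      have "c \<ge> 0" using sep0 True by (simp add: c_def)
      have "feasible T \<U> (x0 + c *\<^sub>R x)"
      proof (rule feasI)
        fix f r
        assume fr: "(f, r) \<in> ?M"
        have "c * dual_apply f x \<le> 0"
          using sep[OF fr] True \<open>c \<ge> 0\<close> by (simp add: mult_nonneg_nonpos)
        then show "dual_apply f (x0 + c *\<^sub>R x) \<le> r"
          using x0M[OF fr] by (simp add: linear_add linear_scale linear_dual_apply)
      qed
      then have "dual_apply f0 x0 + c * dual_apply f0 x \<le> r0"
        using cons by (fastforce simp: linear_add linear_scale linear_dual_apply)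
      then show False using sep0 True by (simp add: c_def)
    next
      case False
      then have "a > 0" using \<open>a \<ge> 0\<close> by simp
      then have "feasible T \<U> ((1 / a) *\<^sub>R x)"
        using sep by (intro feasI)
          (simp add: linear_scale linear_dual_apply pos_divide_le_eq mult.commute)
      then have "dual_apply f0 x / a \<le> r0"
        using cons[of "(1 / a) *\<^sub>R x"] by (simp add: linear_scale linear_dual_apply)
      then show False
        using sep0 \<open>a > 0\<close> by (simp add: pos_divide_le_eq mult.commute)
    qed
  qed
  then show "{(f, r). \<forall>x. feasible T \<U> x \<longrightarrow> dual_apply f x \<le> r} \<subseteq> ?M" by auto
qed

text \<open>Each feasible point contributes a closed half-space, by weak* continuity of
  evaluation.\<close>

lemma closed_consequences: "closed {(f, r). \<forall>x. feasible T \<U> x \<longrightarrow> dual_apply f x \<le> r}"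
proof -
  have "{(f, r). \<forall>x. feasible T \<U> x \<longrightarrow> dual_apply f x \<le> r} =
      (\<Inter>x\<in>Collect (feasible T \<U>). {k. dual_apply (fst k) x \<le> snd k})" by auto
  moreover have "closed {k :: 'a dual \<times> real. dual_apply (fst k) x \<le> snd k}" for x
    by (intro closed_Collect_le continuous_on_snd continuous_on_id
        continuous_on_compose2[OF continuous_on_dual_eval[of UNIV]] continuous_on_fst) auto
  ultimately show ?thesis by auto
qed

lemma convex_consequences: "convex {(f, r). \<forall>x. feasible T \<U> x \<longrightarrow> dual_apply f x \<le> r}"
  by (auto simp: convex_def intro!: add_mono mult_left_mono)

theorem corollary6p4:
  fixes T :: "'t set"
    and \<U> :: "'t \<Rightarrow> ('a::locally_convex_space dual set \<times> real) set"
  assumes "T \<noteq> {}"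
    and "\<And>t. t \<in> T \<Longrightarrow> \<U> t \<noteq> {}"
    and "\<And>t. t \<in> T \<Longrightarrow> \<U> t \<subseteq> closed_convex_sets \<times> UNIV"
    and "\<exists>x. feasible T \<U> x"
  shows "(\<forall>(c :: 'a dual) (s :: real).
            (\<forall>x. feasible T \<U> x \<longrightarrow> dual_apply c x \<ge> s)
            \<longleftrightarrow>
            (\<exists>t\<in>T. \<exists>xs :: ('t \<Rightarrow> 'a dual set \<times> real) \<Rightarrow> 'a dual.
               \<exists>r :: ('t \<Rightarrow> 'a dual set \<times> real) \<Rightarrow> real.
               \<exists>l \<in> nonneg_finite_support (PiE T \<U>).
                 (\<forall>U \<in> PiE T \<U>. (xs U, r U) \<in> pair_set (U t)) \<and>
                 (\<Sum>U \<in> supp_on (PiE T \<U>) l. l U *\<^sub>R xs U) = - c \<and>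
                 (\<Sum>U \<in> supp_on (PiE T \<U>) l. l U * r U) \<le> - s))
         \<longleftrightarrow>
         closed (robust_moment_cone T \<U>) \<and> convex (robust_moment_cone T \<U>)"
proof -
  let ?M = "robust_moment_cone T \<U>"
  let ?N = "{(f, r). \<forall>x. feasible T \<U> x \<longrightarrow> dual_apply f x \<le> r}"
  let ?cert = "\<lambda>c s. \<exists>t\<in>T. (- c, - s) \<in> certified_pairs T \<U> t"
  have "certified_pairs T \<U> t = moment_cone (\<U> t)" if "t \<in> T" for t
    using certified_pairs_subset_moment_cone[OF that, of \<U>]
      moment_cone_certified[where \<U> = \<U>, OF that assms(2) assms(3)[OF that]] by blast
  then have cert: "?cert c s \<longleftrightarrow> (- c, - s) \<in> ?M" for c s
    by (auto simp: robust_moment_cone_eq)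
  have cons: "(\<forall>x. feasible T \<U> x \<longrightarrow> dual_apply c x \<ge> s) \<longleftrightarrow> (- c, - s) \<in> ?N" for c s
    by auto
  have "(\<forall>c s. (- c, - s) \<in> ?N \<longleftrightarrow> (- c, - s) \<in> ?M) \<longleftrightarrow> ?N = ?M"
  proof
    assume *: "\<forall>c s. (- c, - s) \<in> ?N \<longleftrightarrow> (- c, - s) \<in> ?M"
    \<comment> \<open>Negation is a bijection on pairs, so comparing the sets at all
      \<open>(- c, - s)\<close> compares them everywhere.\<close>
    have "(f, r) \<in> ?N \<longleftrightarrow> (f, r) \<in> ?M" for f r
      using *[rule_format, of "- f" "- r"] by (simp only: minus_minus)
    then show "?N = ?M" by (intro set_eqI) (simp only: split_paired_all)
  qed blast
  also have "\<dots> \<longleftrightarrow> closed ?M \<and> convex ?M"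
  proof
    assume "?N = ?M"
    then show "closed ?M \<and> convex ?M"
      using closed_consequences[of T \<U>] convex_consequences[of T \<U>] by simp
  next
    assume "closed ?M \<and> convex ?M"
    then show "?N = ?M" using consequences_eq_moment_cone[OF assms(1,4)] by blast
  qed
  finally show ?thesis
    unfolding cert[symmetric] cons[symmetric]
    unfolding certified_pairs_def mem_Collect_eq prod.case .
qed

end
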